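(* Let $X$ be a separable Banach space and let $(T_t)_{t\ge 0}$ be a $C_0$-semigroup on $X$. Suppose that there exist a dense subset $X_0\subseteq X$ and maps $S_t:X_0\to X$, $t>0$, satisfying: (i) $T_tS_tx=x$ and $T_tS_rx=S_{r-t}x$ for all $x\in X_0$, $t>0$, $r>t>0$; (ii) $t\mapsto T_tx$ is Pettis integrable on $[0,+\infty[$ for all $x\in X_0$; (iii) $t\mapsto S_tx$ is Pettis integrable on $[0,+\infty[$ for all $x\in X_0$. Then $(T_t)_{t\ge 0}$ is frequently hypercyclic.
   Context: A $C_0$-semigroup is a strongly continuous one-parameter semigroup of continuous linear operators. The lower density of a measurable set $M\subset\mathbb{R}_+$ is $\underline{\mathrm{Dens}}(M):=\liminf_{N\to\infty}\mu(M\cap[0,N])/N$, where $\mu$ is Lebesgue measure. A $C_0$-semigroup $(T_t)_{t\ge 0}$ on $X$ is frequently hypercyclic if there exists $x\in X$ such that $\underline{\mathrm{Dens}}(\{t\in\mathbb{R}_+ : T_tx\in U\})>0$ for every non-empty open set $U\subset X$. Pettis integrability: a function $f:[0,+\infty[\to X$ (possibly undefined at the single point $0$) is Pettis integrable (with respect to Lebesgue measure) if for every $\varphi\in X'$ (the topological dual) the scalar function $\varphi\circ f$ is measurable and belongs to $L^1([0,+\infty[)$, and for every measurable $E\subseteq[0,+\infty[$ there is an element $x_E\in X$ with $\varphi(x_E)=\int_E\varphi\circ f\,d\mu$ for all $\varphi\in X'$. The maps $S_t$ are not assumed to be linear or continuous. *)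

theory Defs
  imports "HOL-Analysis.Analysis"
begin

(* Real and complex Banach spaces are treated uniformly.  A type 'k in both real_normed_field and
   euclidean_space is a finite-dimensional real field, i.e. a copy of the reals or of the complex
   numbers.  Class banach only supplies the underlying real Banach space, so the action of the
   scalar field is an explicit parameter. *)
locale banach_over = vector_space smul
  for smul :: "'k::{real_normed_field,euclidean_space} \<Rightarrow> 'a::banach \<Rightarrow> 'a" +
  assumes norm_scale: "norm (smul c x) = norm c * norm x"
    and scale_of_real: "smul (of_real r) x = r *\<^sub>R x"

lemma banach_over_scaleR: "banach_over (scaleR :: real \<Rightarrow> 'a::banach \<Rightarrow> 'a)"
  by unfold_locales (simp_all add: algebra_simps)

lemma banach_over_complex: "banach_over ((*) :: complex \<Rightarrow> complex \<Rightarrow> complex)"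
  by unfold_locales (simp_all add: algebra_simps norm_mult scaleR_conv_of_real)

definition dual :: "('k::{real_normed_field,euclidean_space} \<Rightarrow> 'a::banach \<Rightarrow> 'a) \<Rightarrow> ('a \<Rightarrow> 'k) set"
  where "dual smul = {\<phi>. Vector_Spaces.linear smul (*) \<phi> \<and> continuous_on UNIV \<phi>}"

(* The operators T t with t < 0 are junk and are never constrained. *)
definition C0_semigroup ::
    "('k::{real_normed_field,euclidean_space} \<Rightarrow> 'a::banach \<Rightarrow> 'a) \<Rightarrow> (real \<Rightarrow> 'a \<Rightarrow> 'a) \<Rightarrow> bool"
  where "C0_semigroup smul T \<longleftrightarrow>
    (\<forall>t\<ge>0. Vector_Spaces.linear smul smul (T t) \<and> continuous_on UNIV (T t)) \<and>
    (\<forall>x. T 0 x = x) \<and>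
    (\<forall>s\<ge>0. \<forall>t\<ge>0. \<forall>x. T (s + t) x = T s (T t x)) \<and>
    (\<forall>x. continuous_on {0..} (\<lambda>t. T t x))"

(* The limit inferior is over real N; it is taken in ereal. *)
definition lower_density :: "real set \<Rightarrow> ereal"
  where "lower_density M = Liminf at_top (\<lambda>N::real. ereal (measure lebesgue (M \<inter> {0..N}) / N))"

definition frequently_hypercyclic :: "(real \<Rightarrow> 'a::topological_space \<Rightarrow> 'a) \<Rightarrow> bool"
  where "frequently_hypercyclic T \<longleftrightarrow>
    (\<exists>x. \<forall>U. open U \<and> U \<noteq> {} \<longrightarrow> lower_density {t. 0 \<le> t \<and> T t x \<in> U} > 0)"

(* Integrability includes measurability.  Only the values of f on [0, infinity) matter, and since
   {0} is a null set for the complete measure lebesgue, the value at 0 is irrelevant as well. *)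
definition pettis_integrable ::
    "('k::{real_normed_field,euclidean_space} \<Rightarrow> 'a::banach \<Rightarrow> 'a) \<Rightarrow> (real \<Rightarrow> 'a) \<Rightarrow> bool"
  where "pettis_integrable smul f \<longleftrightarrow>
    (\<forall>\<phi>\<in>dual smul. set_integrable lebesgue {0..} (\<lambda>t. \<phi> (f t))) \<and>
    (\<forall>E. E \<in> sets lebesgue \<and> E \<subseteq> {0..} \<longrightarrow>
      (\<exists>x. \<forall>\<phi>\<in>dual smul. \<phi> x = (LINT t:E|lebesgue. \<phi> (f t))))"

end

theory Submission
  imports Defs
begin

text \<open>
  The orbit of each \<open>x \<in> X0\<close> extends to a continuous curve on the whole line: put \<open>G t = T t x\<close>
  for \<open>t \<ge> 0\<close> and \<open>G t = S (- t) x\<close> for \<open>t < 0\<close>; the semigroup law and the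
  two identities for \<open>S\<close> together say that \<open>T s (G t) = G (t + s)\<close> for \<open>s \<ge> 0\<close>. Averaging \<open>G\<close>
  over \<open>{j..j + \<delta>}\<close>, for integers \<open>j\<close>, gives vectors \<open>v j\<close> with \<open>T m (v j) = v (j + m)\<close>, and \<open>v 0\<close> is as close to \<open>x\<close> as desired.

  Pettis integrability says that the series of the \<open>v j\<close>, over \<open>j \<ge> 0\<close> and over \<open>j < 0\<close>, is weakly
  subseries convergent: the sum over an index set is the Pettis integral over the union of the
  intervals. The Orlicz-Pettis theorem (\<open>Orlicz_Pettis\<close>) turns this into norm smallness of
  all finite sums over indices far from \<open>0\<close>. Its proof here applies the Baire category theorem to the
  Cantor space of index sets, covered by countably many closed sets because the space is separable;
  their closedness comes from norming functionals, hence from the Hahn-Banach theorem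
  (\<open>Hahn_Banach_sublinear\<close>). Functionals with values in the scalar field and real functionals carry
  the same information (\<open>real_functional_factors_through_dual\<close>).

  Doing this for countably many \<open>x\<close> gives orbits \<open>v l\<close> whose vectors \<open>v l 0\<close> are dense. For suitable
  integers \<open>a l i\<close> the vector \<open>z = (\<Sum>l. \<Sum>i. v l (- a l i))\<close> exists, and in
  \<open>T (a l i) z = (\<Sum>k. \<Sum>j. v k (a l i - a k j))\<close> the term \<open>(k, j) = (l, i)\<close> is \<open>v l 0\<close>, while all the
  others together are small as soon as the integers are far enough apart
  (\<open>frequently_visiting_vector\<close>). Such integers exist with linear growth in \<open>i\<close> for each
  \<open>l\<close> (\<open>separated_sequences\<close>), which is positive lower density. By strong continuity and one more use of
  Baire's theorem, a visit of the orbit of \<open>z\<close> to a suitable open set at an integer time keeps it in the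
  target set for a fixed length of time (\<open>semigroup_keeps_open_set_inside\<close>), so that the density
  of integer times becomes a density for Lebesgue measure.
\<close>

section \<open>The Hahn-Banach theorem and norming functionals\<close>

definition sublinear :: "('a::real_vector \<Rightarrow> real) \<Rightarrow> bool" where
  "sublinear p \<longleftrightarrow> (\<forall>x y. p (x + y) \<le> p x + p y) \<and> (\<forall>x. \<forall>t\<ge>0. p (t *\<^sub>R x) \<le> t * p x)"

lemma sublinearI:
  assumes "\<And>x y. p (x + y) \<le> p x + p y" and "\<And>x t. t \<ge> 0 \<Longrightarrow> p (t *\<^sub>R x) \<le> t * p x"
  shows "sublinear p"
  using assms by (auto simp: sublinear_def)

lemma sublinear_add: "sublinear p \<Longrightarrow> p (x + y) \<le> p x + p y"
  by (auto simp: sublinear_def)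

lemma sublinear_zero:
  assumes "sublinear p" shows "p 0 = 0"
proof -
  have "p (0 *\<^sub>R 0) \<le> 0 * p 0" using assms unfolding sublinear_def by blast
  moreover have "p (0 + 0) \<le> p 0 + p 0" by (rule sublinear_add[OF assms])
  ultimately show ?thesis by simp
qed

lemma sublinear_scale:
  assumes "sublinear p" "t \<ge> 0" shows "p (t *\<^sub>R x) = t * p x"
proof (cases "t = 0")
  case True then show ?thesis using sublinear_zero[OF assms(1)] by simp
next
  case False
  with assms have t: "t > 0" by simp
  have "p (inverse t *\<^sub>R (t *\<^sub>R x)) \<le> inverse t * p (t *\<^sub>R x)"
    using assms t unfolding sublinear_def by (meson inverse_nonnegative_iff_nonnegative less_imp_le)
  then have "t * p x \<le> p (t *\<^sub>R x)" using t by (simp add: field_simps)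
  moreover have "p (t *\<^sub>R x) \<le> t * p x" using assms unfolding sublinear_def by blast
  ultimately show ?thesis by simp
qed

lemma sublinear_ge:
  assumes "sublinear p" shows "- p (- x) \<le> p x"
  using sublinear_add[OF assms, of x "-x"] sublinear_zero[OF assms] by simp

text \<open>
  For sublinear \<open>q\<close>, the greatest sublinear functional below \<open>q\<close> whose value at \<open>- a\<close> is at most \<open>- q a\<close>.
\<close>

definition tilt :: "('a::real_vector \<Rightarrow> real) \<Rightarrow> 'a \<Rightarrow> 'a \<Rightarrow> real" where
  "tilt q a x = (INF t\<in>{0..}. q (x + t *\<^sub>R a) - t * q a)"

lemma tilt_bdd:
  assumes "sublinear q"
  shows "bdd_below ((\<lambda>t. q (x + t *\<^sub>R a) - t * q a) ` {0..})"
proof (rule bdd_belowI2)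
  fix t :: real assume "t \<in> {0..}"
  then have "t * q a \<le> q (x + t *\<^sub>R a) + q (- x)"
    using sublinear_add[OF assms, of "x + t *\<^sub>R a" "-x"] sublinear_scale[OF assms, of t a] by simp
  then show "- q (- x) \<le> q (x + t *\<^sub>R a) - t * q a" by simp
qed

lemma tilt_le:
  assumes "sublinear q" "t \<ge> 0"
  shows "tilt q a x \<le> q (x + t *\<^sub>R a) - t * q a"
  unfolding tilt_def by (rule cINF_lower[OF tilt_bdd[OF assms(1)]]) (use assms in simp)

lemma tilt_greatest:
  assumes "\<And>t. t \<ge> 0 \<Longrightarrow> c \<le> q (x + t *\<^sub>R a) - t * q a"
  shows "c \<le> tilt q a x"
  unfolding tilt_def by (rule cINF_greatest) (use assms in auto)

lemma sublinear_tilt: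
  assumes q: "sublinear q"
  shows "sublinear (tilt q a)"
proof (rule sublinearI)
  fix x y
  have "tilt q a (x + y) - (q (x + s *\<^sub>R a) - s * q a) \<le> tilt q a y" if s: "s \<ge> 0" for s
  proof (rule tilt_greatest)
    fix t :: real assume t: "t \<ge> 0"
    have "tilt q a (x + y) \<le> q ((x + y) + (s + t) *\<^sub>R a) - (s + t) * q a"
      by (rule tilt_le[OF q]) (use s t in simp)
    also have "(x + y) + (s + t) *\<^sub>R a = (x + s *\<^sub>R a) + (y + t *\<^sub>R a)"
      by (simp add: algebra_simps)
    finally show "tilt q a (x + y) - (q (x + s *\<^sub>R a) - s * q a) \<le> q (y + t *\<^sub>R a) - t * q a"
      using sublinear_add[OF q, of "x + s *\<^sub>R a" "y + t *\<^sub>R a"] by (simp add: algebra_simps)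
  qed
  then have "tilt q a (x + y) - tilt q a y \<le> tilt q a x"
    by (intro tilt_greatest) (simp add: algebra_simps)
  then show "tilt q a (x + y) \<le> tilt q a x + tilt q a y" by simp
next
  fix x and t :: real assume t: "t \<ge> 0"
  show "tilt q a (t *\<^sub>R x) \<le> t * tilt q a x"
  proof (cases "t = 0")
    case True
    then show ?thesis using tilt_le[OF q, of 0 a 0] sublinear_zero[OF q] by simp
  next
    case False
    with t have t: "t > 0" by simp
    have "tilt q a (t *\<^sub>R x) / t \<le> tilt q a x"
    proof (rule tilt_greatest)
      fix s :: real assume s: "s \<ge> 0"
      have "tilt q a (t *\<^sub>R x) \<le> q (t *\<^sub>R x + (t * s) *\<^sub>R a) - (t * s) * q a"
        by (rule tilt_le[OF q]) (use s t in simp)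
      also have "t *\<^sub>R x + (t * s) *\<^sub>R a = t *\<^sub>R (x + s *\<^sub>R a)"
        by (simp add: algebra_simps)
      also have "q \<dots> - t * s * q a = t * (q (x + s *\<^sub>R a) - s * q a)"
        by (subst sublinear_scale[OF q less_imp_le[OF t]]) (simp add: algebra_simps)
      finally show "tilt q a (t *\<^sub>R x) / t \<le> q (x + s *\<^sub>R a) - s * q a"
        using t by (simp add: field_simps)
    qed
    then show ?thesis using t by (simp add: field_simps)
  qed
qed

text \<open>
  Zorn's lemma for the reversed pointwise order. A chain below \<open>p\<close> has a pointwise infimum, since
  \<open>q x \<ge> - q (- x) \<ge> - p (- x)\<close> bounds it from below; the infimum is subadditive because any two
  members of the chain can be compared.
\<close>

lemma exists_minimal_sublinear:
  fixes p :: "'a::real_vector \<Rightarrow> real"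
  assumes p: "sublinear p"
  shows "\<exists>m. sublinear m \<and> m \<le> p \<and> (\<forall>q. sublinear q \<longrightarrow> q \<le> m \<longrightarrow> q = m)"
proof -
  define A where "A = {q. sublinear q \<and> q \<le> p}"
  define P where "P = (\<lambda>q r :: 'a \<Rightarrow> real. r \<le> q)"
  have "\<exists>m \<in> A. \<forall>q \<in> A. P m q \<longrightarrow> q = m"
  proof (rule predicate_Zorn)
    show "partial_order_on A (relation_of P A)"
      by (rule partial_order_on_relation_ofI) (auto simp: P_def)
  next
    fix C assume "C \<in> Chains (relation_of P A)"
    then have CA: "C \<subseteq> A" and tot: "\<And>q r. q \<in> C \<Longrightarrow> r \<in> C \<Longrightarrow> q \<le> r \<or> r \<le> q"
      by (auto simp: Chains_def relation_of_def P_def)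
    show "\<exists>u\<in>A. \<forall>a\<in>C. P a u"
    proof (cases "C = {}")
      case True
      then show ?thesis using p by (auto simp: A_def)
    next
      case False
      define m where "m x = (INF q\<in>C. q x)" for x
      have bdd: "bdd_below ((\<lambda>q. q x) ` C)" for x
      proof (rule bdd_belowI2)
        fix q assume "q \<in> C"
        then have "sublinear q" "q (- x) \<le> p (- x)" using CA by (auto simp: A_def le_fun_def)
        then show "- p (- x) \<le> q x" using sublinear_ge[of q x] by simp
      qed
      have mle: "m x \<le> q x" if "q \<in> C" for q x
        unfolding m_def by (rule cINF_lower[OF bdd that])
      have mge: "c \<le> m x" if "\<And>q. q \<in> C \<Longrightarrow> c \<le> q x" for c x
        unfolding m_def by (rule cINF_greatest) (use that False in auto)
      have "sublinear m"
      proof (rule sublinearI)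
        fix x y
        have *: "m (x + y) \<le> q x + r y" if qr: "q \<in> C" "r \<in> C" for q r
        proof -
          have "sublinear q" "sublinear r" using qr CA by (auto simp: A_def)
          with tot[OF qr] show ?thesis
            using mle[OF qr(1), of "x + y"] mle[OF qr(2), of "x + y"]
              sublinear_add[of q x y] sublinear_add[of r x y]
            unfolding le_fun_def by (smt (verit))
        qed
        have "m (x + y) - q x \<le> m y" if "q \<in> C" for q
          by (rule mge) (use *[OF that] in \<open>simp add: algebra_simps\<close>)
        then have "m (x + y) - m y \<le> m x" by (intro mge) (simp add: algebra_simps)
        then show "m (x + y) \<le> m x + m y" by simp
      next
        fix x and t :: real assume t: "t \<ge> 0"
        have sc: "m (t *\<^sub>R x) \<le> t * q x" if "q \<in> C" for q
          using mle[OF that, of "t *\<^sub>R x"] sublinear_scale[of q t x] that CA t by (auto simp: A_def)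
        show "m (t *\<^sub>R x) \<le> t * m x"
        proof (cases "t = 0")
          case True
          then show ?thesis using sc False by auto
        next
          case False
          with t have t: "t > 0" by simp
          have "m (t *\<^sub>R x) / t \<le> m x" by (rule mge) (use sc t in \<open>simp add: field_simps\<close>)
          then show ?thesis using t by (simp add: field_simps)
        qed
      qed
      moreover have "m \<le> p"
      proof -
        obtain q where "q \<in> C" using False by auto
        then show ?thesis using mle[of q] CA by (force simp: A_def le_fun_def intro: order_trans)
      qed
      ultimately show ?thesis using mle by (auto simp: A_def P_def le_fun_def intro!: bexI[of _ m])
    qed
  qed
  then show ?thesis unfolding A_def P_def by (auto intro: order_trans)
qed

text \<open>
  A minimal sublinear functional \<open>m\<close> below \<open>p\<close> is linear: tilting cannot make it smaller, so
  \<open>m x \<le> m (x + y) - m y\<close>, which with subadditivity gives additivity.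
\<close>

theorem Hahn_Banach_sublinear:
  fixes p :: "'a::real_vector \<Rightarrow> real"
  assumes p: "sublinear p"
  shows "\<exists>f. linear f \<and> (\<forall>x. f x \<le> p x)"
proof -
  obtain m where m: "sublinear m" "m \<le> p" and min: "\<And>q. sublinear q \<Longrightarrow> q \<le> m \<Longrightarrow> q = m"
    using exists_minimal_sublinear[OF p] by blast
  have tm: "tilt m a = m" for a
    by (rule min[OF sublinear_tilt[OF m(1)]]) (use tilt_le[OF m(1), of 0 a] in \<open>auto simp: le_fun_def\<close>)
  have add: "m (x + y) = m x + m y" for x y
    using tilt_le[OF m(1), of 1 y x] sublinear_add[OF m(1), of x y] by (simp add: tm)
  have neg: "m (- x) = - m x" for x
    using add[of x "- x"] sublinear_zero[OF m(1)] by simp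
  have "m (c *\<^sub>R x) = c * m x" for c x
  proof (cases "c \<ge> 0")
    case True then show ?thesis by (rule sublinear_scale[OF m(1)])
  next
    case False
    then have "m ((-c) *\<^sub>R x) = (-c) * m x" by (intro sublinear_scale[OF m(1)]) simp
    then show ?thesis using neg[of "c *\<^sub>R x"] by simp
  qed
  with add have "linear m" by (intro linearI) auto
  with m show ?thesis by (auto simp: le_fun_def)
qed

text \<open>
  Tilting the norm in direction \<open>a\<close> gives a sublinear functional that is at most \<open>- norm a\<close> at \<open>- a\<close>.
  A linear functional below it is dominated by the norm and attains the norm at \<open>a\<close>.
\<close>

lemma norming_functional:
  fixes a :: "'a::real_normed_vector"
  shows "\<exists>u. bounded_linear u \<and> (\<forall>x. \<bar>u x\<bar> \<le> norm x) \<and> u a = norm a"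
proof -
  have norm: "sublinear (norm :: 'a \<Rightarrow> real)"
    by (rule sublinearI) (auto simp: norm_triangle_ineq)
  obtain f where f: "linear f" "\<And>x. f x \<le> tilt norm a x"
    using Hahn_Banach_sublinear[OF sublinear_tilt[OF norm]] by blast
  have le: "f x \<le> norm x" for x
    using f(2)[of x] tilt_le[OF norm, of 0 a x] by simp
  have abs: "\<bar>f x\<bar> \<le> norm x" for x
    using le[of x] le[of "- x"] linear_neg[OF f(1), of x] by simp
  have "f (- a) \<le> - norm a"
    using f(2)[of "- a"] tilt_le[OF norm, of 1 a "- a"] by simp
  then have "f a \<ge> norm a" using linear_neg[OF f(1), of a] by simp
  with le[of a] have "f a = norm a" by simp
  moreover have "bounded_linear f"
    using f(1) abs by (intro bounded_linear_intro[of _ 1]) (auto simp: linear_add linear_cmul)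
  ultimately show ?thesis using abs by blast
qed

section \<open>Real functionals and the dual over the scalar field\<close>

text \<open>
  For \<open>l c = c \<bullet> 1\<close> the form \<open>l (a * c)\<close> on the scalar field is nondegenerate, since
  \<open>l (inverse c * c) = 1\<close>. Hence for each \<open>x\<close> the real-linear map \<open>a \<mapsto> u (smul a x)\<close> equals
  \<open>a \<mapsto> l (a * \<phi> x)\<close> for exactly one scalar \<open>\<phi> x\<close>, and uniqueness makes \<open>\<phi>\<close> linear over the scalar field.
  For the complex numbers this is the usual passage from a real functional to a complex one with the
  same real part; the argument here covers all admissible scalar fields at once.
\<close>

lemma real_functional_factors_through_dual:
  fixes smul :: "'k::{real_normed_field,euclidean_space} \<Rightarrow> 'a::banach \<Rightarrow> 'a" and u :: "'a \<Rightarrow> real"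
  assumes b: "banach_over smul" and u: "bounded_linear u"
  shows "\<exists>\<phi>\<in>dual smul. \<exists>l. bounded_linear l \<and> (\<forall>x. u x = l (\<phi> x))"
proof -
  interpret banach_over smul by (rule b)
  interpret u: bounded_linear u by (rule u)
  define l :: "'k \<Rightarrow> real" where "l c = c \<bullet> 1" for c
  have bl: "bounded_linear l" unfolding l_def by (rule bounded_linear_inner_left)
  interpret l: bounded_linear l by (rule bl)
  have scaleR_smul: "smul (r *\<^sub>R c) x = r *\<^sub>R smul c x" for r c x
    by (simp add: scaleR_conv_of_real scale_of_real flip: scale_scale)
  have smul_scaleR: "smul c (r *\<^sub>R x) = r *\<^sub>R smul c x" for r c x
    by (metis scale_left_commute scale_of_real)
  have bls: "bounded_linear (smul c)" for c
    by (rule bounded_linear_intro[of _ "norm c"])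
      (simp_all add: scale_right_distrib smul_scaleR norm_scale mult.commute)
  define L :: "'k \<Rightarrow> 'k" where "L c = (\<Sum>i\<in>Basis. l (i * c) *\<^sub>R i)" for c
  have L_inner: "L c \<bullet> i = l (i * c)" if "i \<in> Basis" for c i
    using that by (simp add: L_def inner_sum_left inner_Basis if_distrib cong: if_cong)
  have linL: "linear L"
    unfolding L_def
    by (intro linearI)
      (simp_all add: distrib_left l.add scaleR_left_distrib sum.distrib l.scaleR scaleR_sum_right)
  have ext: "l (a * c) = r a"
    if "linear r" "\<And>i. i \<in> Basis \<Longrightarrow> l (i * c) = r i" for c a and r :: "'k \<Rightarrow> real"
  proof -
    have "linear (\<lambda>a. l (a * c))"
      by (intro linearI) (simp_all add: distrib_right l.add l.scaleR)
    from linear_eq_on[OF this that(1), of a Basis] that(2) show ?thesis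
      by (simp add: span_Basis)
  qed
  have nondeg: "c = 0" if "\<And>a. l (a * c) = 0" for c
  proof (rule ccontr)
    assume "c \<noteq> 0"
    then have "l (inverse c * c) = 1"
      by (simp add: l_def dot_square_norm)
    with that show False by simp
  qed
  have "inj L"
  proof (subst linear_injective_0[OF linL], intro allI impI)
    fix c assume "L c = 0"
    then have "l (i * c) = 0" if "i \<in> Basis" for i using L_inner[OF that, of c] by simp
    then have "l (a * c) = 0" for a by (rule ext[of "\<lambda>_. 0", OF linear_zero])
    then show "c = 0" by (rule nondeg)
  qed
  with linL have surj: "surj L" by (intro linear_injective_imp_surjective refl)
  define w :: "'a \<Rightarrow> 'k" where "w x = (\<Sum>i\<in>Basis. u (smul i x) *\<^sub>R i)" for x
  define \<phi> where "\<phi> x = inv L (w x)" for x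
  have rep: "l (a * \<phi> x) = u (smul a x)" for a x
  proof (rule ext)
    show "linear (\<lambda>a. u (smul a x))"
      by (intro linearI) (simp_all add: scale_left_distrib u.add scaleR_smul u.scaleR)
    fix i :: 'k assume i: "i \<in> Basis"
    have "L (\<phi> x) = w x" unfolding \<phi>_def by (rule surj_f_inv_f[OF surj])
    moreover have "w x \<bullet> i = u (smul i x)"
      using i by (simp add: w_def inner_sum_left inner_Basis if_distrib cong: if_cong)
    ultimately show "l (i * \<phi> x) = u (smul i x)" using L_inner[OF i] by metis
  qed
  have uniq: "c = d" if "\<And>a. l (a * c) = l (a * d)" for c d
  proof -
    have "c - d = 0" by (rule nondeg) (simp add: right_diff_distrib l.diff that)
    then show ?thesis by simp
  qed
  have "Vector_Spaces.linear smul (*) \<phi>"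
  proof (unfold_locales)
    show "\<phi> (x + y) = \<phi> x + \<phi> y" for x y
      by (rule uniq) (simp add: distrib_left l.add rep scale_right_distrib u.add)
    show "\<phi> (smul c x) = c * \<phi> x" for c x
      by (rule uniq) (metis mult.assoc rep scale_scale)
  qed
  moreover have "continuous_on UNIV \<phi>"
  proof -
    have "linear (inv L)" by (rule inj_linear_imp_inv_linear[OF linL \<open>inj L\<close>])
    then have "continuous_on UNIV (inv L)"
      by (simp add: linear_continuous_on linear_conv_bounded_linear)
    moreover have "continuous_on UNIV w"
      unfolding w_def by (intro continuous_intros bounded_linear.continuous_on[OF u] bounded_linear.continuous_on[OF bls])
    ultimately show ?thesis unfolding \<phi>_def
      by (rule continuous_on_compose2) simp
  qed
  moreover have "u x = l (\<phi> x)" for x using rep[of 1 x] by simp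
  ultimately show ?thesis using bl by (auto simp: dual_def)
qed

lemma pettis_integrable_real:
  fixes smul :: "'k::{real_normed_field,euclidean_space} \<Rightarrow> 'a::banach \<Rightarrow> 'a"
  assumes b: "banach_over smul" and f: "pettis_integrable smul f"
  shows "bounded_linear u \<Longrightarrow> set_integrable lebesgue {0..} (\<lambda>t. u (f t) :: real)"
    and "E \<in> sets lebesgue \<Longrightarrow> E \<subseteq> {0..} \<Longrightarrow>
      \<exists>x. \<forall>u. bounded_linear u \<longrightarrow> u x = (LINT t:E|lebesgue. u (f t) :: real)"
proof -
  have int: "set_integrable lebesgue {0..} (\<lambda>t. \<phi> (f t))" if "\<phi> \<in> dual smul" for \<phi>
    using f that unfolding pettis_integrable_def by blast
  show "set_integrable lebesgue {0..} (\<lambda>t. u (f t) :: real)" if u: "bounded_linear u" for u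
  proof -
    obtain \<phi> l where \<phi>: "\<phi> \<in> dual smul" and l: "bounded_linear l" and ul: "\<And>x. u x = l (\<phi> x)"
      using real_functional_factors_through_dual[OF b u] by metis
    show ?thesis
      using integrable_bounded_linear[OF l int[OF \<phi>, unfolded set_integrable_def]]
      by (simp add: set_integrable_def ul linear_cmul bounded_linear.linear[OF l])
  qed
  show "\<exists>x. \<forall>u. bounded_linear u \<longrightarrow> u x = (LINT t:E|lebesgue. u (f t) :: real)"
    if E: "E \<in> sets lebesgue" "E \<subseteq> {0..}" for E
  proof -
    obtain x where x: "\<And>\<phi>. \<phi> \<in> dual smul \<Longrightarrow> \<phi> x = (LINT t:E|lebesgue. \<phi> (f t))"
      using f E unfolding pettis_integrable_def by metis
    have "u x = (LINT t:E|lebesgue. u (f t))" if u: "bounded_linear u" for u :: "'a \<Rightarrow> real"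
    proof -
      obtain \<phi> l where \<phi>: "\<phi> \<in> dual smul" and l: "bounded_linear l" and ul: "\<And>x. u x = l (\<phi> x)"
        using real_functional_factors_through_dual[OF b u] by metis
      have "set_integrable lebesgue E (\<lambda>t. \<phi> (f t))"
        by (rule set_integrable_subset[OF int[OF \<phi>] E])
      then show ?thesis
        using integral_bounded_linear[OF l, of lebesgue "\<lambda>t. indicator E t *\<^sub>R \<phi> (f t)"]
        by (simp add: set_integrable_def set_lebesgue_integral_def ul x[OF \<phi>]
            linear_cmul bounded_linear.linear[OF l])
    qed
    then show ?thesis by blast
  qed
qed

section \<open>Unconditional smallness and the Orlicz-Pettis theorem\<close>

text \<open>
  The Cauchy condition for unconditional convergence. The function \<open>h\<close> measures how far out an index
  lies, so that series indexed by the naturals and by the integers share the notion.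
\<close>

definition unconditionally_small_tails :: "('i \<Rightarrow> nat) \<Rightarrow> ('i \<Rightarrow> 'a::real_normed_vector) \<Rightarrow> bool" where
  "unconditionally_small_tails h v \<longleftrightarrow>
    (\<forall>\<epsilon>>0. \<exists>N. \<forall>F. finite F \<longrightarrow> (\<forall>i\<in>F. N \<le> h i) \<longrightarrow> norm (sum v F) \<le> \<epsilon>)"

text \<open>
  Baire's theorem in the form used twice below: once in the Cantor space of index sets and once in the
  Banach space itself.
\<close>

lemma Baire_closed_cover:
  fixes C :: "nat \<Rightarrow> 'a::topological_space set"
  assumes "completely_metrizable_space (euclidean :: 'a topology) \<or>
      locally_compact_space (euclidean :: 'a topology) \<and> regular_space (euclidean :: 'a topology)"
    and "\<And>k. closed (C k)" and "open U" "U \<noteq> {}" "U \<subseteq> (\<Union>k. C k)"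
  obtains k where "interior (C k) \<noteq> {}"
proof -
  have "\<exists>k. interior (C k) \<noteq> {}"
  proof (rule ccontr)
    assume "\<not> ?thesis"
    then have "euclidean interior_of \<Union>(range C) = {}"
      by (intro Baire_category_alt assms) (use assms(2) in auto)
    moreover have "U \<subseteq> interior (\<Union>k. C k)" using assms by (intro interior_maximal)
    ultimately show False using assms(4) by (simp add: euclidean_interior_of)
  qed
  with that show ?thesis by blast
qed

lemma open_nat_bool_cylinder:
  fixes W :: "(nat \<Rightarrow> bool) set"
  assumes "open W" "A \<in> W"
  obtains N where "\<And>B. (\<And>n. n < N \<Longrightarrow> B n = A n) \<Longrightarrow> B \<in> W"
proof -
  have "\<exists>N. \<forall>B. (\<forall>n<N. B n = A n) \<longrightarrow> B \<in> W"
  proof -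
    obtain X where X: "A \<in> Pi\<^sub>E UNIV X" "finite {i. X i \<noteq> UNIV}" "Pi\<^sub>E UNIV X \<subseteq> W"
      using product_topology_open_contains_basis[of "\<lambda>_. euclidean" UNIV W A] assms
      unfolding open_fun_def by auto
    obtain N where N: "\<And>i. X i \<noteq> UNIV \<Longrightarrow> i < N"
      using X(2) unfolding finite_nat_set_iff_bounded by auto
    have "B \<in> W" if "\<forall>n<N. B n = A n" for B
    proof -
      have "B i \<in> X i" for i
        using that X(1) N[of i] by (cases "X i = UNIV") (auto simp: PiE_iff)
      then show ?thesis using X(3) by (auto simp: PiE_iff)
    qed
    then show ?thesis by blast
  qed
  with that show ?thesis by blast
qed

text \<open>
  Write \<open>x A\<close> for the weak sum over the index set \<open>A\<close>. For each functional \<open>u\<close> the map \<open>A \<mapsto> u (x A)\<close> is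
  continuous on the Cantor space, by absolute convergence; as closed balls are intersections of weakly
  closed half-spaces, the preimage under \<open>x\<close> of a closed ball is closed. Countably many balls of
  radius \<open>\<epsilon> / 2\<close> cover the space, so one preimage contains a cylinder: all index sets that agree with some
  \<open>A\<close> below \<open>N\<close>. Two members of this cylinder that differ by a finite \<open>F \<subseteq> {N..}\<close> have sums at distance
  at most \<open>\<epsilon>\<close>.
\<close>

lemma Orlicz_Pettis:
  fixes a :: "nat \<Rightarrow> 'a::real_normed_vector"
  assumes sep: "separable_space (euclidean :: 'a topology)"
    and abs: "\<And>u :: 'a \<Rightarrow> real. bounded_linear u \<Longrightarrow> summable (\<lambda>n. \<bar>u (a n)\<bar>)"
    and sub: "\<And>A. \<exists>x. \<forall>u :: 'a \<Rightarrow> real. bounded_linear u \<longrightarrow> u x = (\<Sum>n. if A n then u (a n) else 0)"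
  shows "unconditionally_small_tails id a"
  unfolding unconditionally_small_tails_def
proof (intro allI impI)
  fix \<epsilon> :: real assume e: "\<epsilon> > 0"
  obtain x where x: "\<And>A (u :: 'a \<Rightarrow> real). bounded_linear u \<Longrightarrow> u (x A) = (\<Sum>n. if A n then u (a n) else 0)"
    using sub by metis
  obtain D :: "'a set" where D: "countable D" "closure D = UNIV"
    using sep unfolding separable_space_def by auto
  then have "D \<noteq> {}" by auto
  then obtain q :: "nat \<Rightarrow> 'a" where q: "range q = D"
    using D(1) uncountable_def by metis
  define Fs :: "('a \<Rightarrow> real) set" where "Fs = {u. bounded_linear u \<and> (\<forall>z. \<bar>u z\<bar> \<le> norm z)}"
  have ball: "norm z \<le> r" if "\<And>u. u \<in> Fs \<Longrightarrow> \<bar>u z\<bar> \<le> r" for z r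
  proof -
    obtain u where "u \<in> Fs" "u z = norm z"
      using norming_functional[of z] by (auto simp: Fs_def)
    with that[of u] show ?thesis by simp
  qed
  define C where "C k = {A :: nat \<Rightarrow> bool. norm (x A - q k) \<le> \<epsilon> / 2}" for k
  have C_eq: "C k = (\<Inter>u\<in>Fs. {A. \<bar>u (x A) - u (q k)\<bar> \<le> \<epsilon> / 2})" for k
  proof (intro set_eqI iffI)
    fix A assume "A \<in> C k"
    then have "norm (x A - q k) \<le> \<epsilon> / 2" by (simp add: C_def)
    then have "\<bar>u (x A - q k)\<bar> \<le> \<epsilon> / 2" if "u \<in> Fs" for u
      using that unfolding Fs_def by (blast intro: order_trans)
    then show "A \<in> (\<Inter>u\<in>Fs. {A. \<bar>u (x A) - u (q k)\<bar> \<le> \<epsilon> / 2})"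
      by (auto simp: Fs_def bounded_linear.linear linear_diff)
  next
    fix A assume A: "A \<in> (\<Inter>u\<in>Fs. {A. \<bar>u (x A) - u (q k)\<bar> \<le> \<epsilon> / 2})"
    have "norm (x A - q k) \<le> \<epsilon> / 2"
      by (rule ball) (use A in \<open>auto simp: Fs_def bounded_linear.linear linear_diff\<close>)
    then show "A \<in> C k" by (simp add: C_def)
  qed
  have cont: "continuous_on UNIV (\<lambda>A. u (x A))" if "bounded_linear u" for u :: "'a \<Rightarrow> real"
  proof -
    have "uniform_limit UNIV (\<lambda>n A. \<Sum>i<n. if A i then u (a i) else 0)
        (\<lambda>A. \<Sum>i. if A i then u (a i) else 0) sequentially"
      by (rule Weierstrass_m_test[OF _ abs[OF that]]) auto
    then have "continuous_on UNIV (\<lambda>A. \<Sum>i. if A i then u (a i) else 0)"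
    proof (rule uniform_limit_theorem[rotated])
      have "continuous_on UNIV (\<lambda>A :: nat \<Rightarrow> bool. if A i then u (a i) else 0)" for i
        by (rule continuous_on_compose2[of UNIV "\<lambda>b. if b then u (a i) else 0" UNIV "\<lambda>A. A i"])
          (auto intro: continuous_on_discrete)
      then show "\<forall>\<^sub>F n in sequentially. continuous_on UNIV (\<lambda>A. \<Sum>i<n. if A i then u (a i) else 0)"
        by (intro always_eventually allI continuous_on_sum) auto
    qed simp
    then show ?thesis by (simp add: x[OF that])
  qed
  have closed: "closed (C k)" for k
    unfolding C_eq
    by (intro closed_INT ballI closed_Collect_le continuous_intros cont) (auto simp: Fs_def)
  have cover: "UNIV \<subseteq> (\<Union>k. C k)"
  proof
    fix A
    have "x A \<in> closure D" using D by simp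
    then obtain d where "d \<in> D" "dist d (x A) < \<epsilon> / 2"
      using e unfolding closure_approachable by (meson half_gt_zero)
    then obtain k where "dist (q k) (x A) < \<epsilon> / 2" using q by auto
    then show "A \<in> (\<Union>k. C k)" by (auto simp: C_def dist_norm norm_minus_commute intro!: exI[of _ k])
  qed
  have lc: "locally_compact_space (euclidean :: (nat \<Rightarrow> bool) topology) \<and>
      regular_space (euclidean :: (nat \<Rightarrow> bool) topology)"
  proof -
    have "compact (UNIV :: bool set)" by (rule finite_imp_compact) simp
    then have "compact_space (euclidean :: bool topology)" by (simp add: compact_space_def)
    then have c: "compact_space (euclidean :: (nat \<Rightarrow> bool) topology)"
      by (simp add: euclidean_product_topology[symmetric] compact_space_product_topology)
    have "Hausdorff_space (euclidean :: bool topology)"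
      unfolding Hausdorff_space_def
    proof (intro allI impI)
      fix y z :: bool assume "y \<in> topspace euclidean \<and> z \<in> topspace euclidean \<and> y \<noteq> z"
      then show "\<exists>U V. openin euclidean U \<and> openin euclidean V \<and> y \<in> U \<and> z \<in> V \<and> disjnt U V"
        by (intro exI[of _ "{y}"] exI[of _ "{z}"]) (auto simp: open_discrete)
    qed
    then have h: "Hausdorff_space (euclidean :: (nat \<Rightarrow> bool) topology)"
      using Hausdorff_space_product_topology[of "\<lambda>_. euclidean :: bool topology" "UNIV :: nat set"]
      by (simp add: euclidean_product_topology)
    from c h show ?thesis
      by (simp add: compact_imp_locally_compact_space compact_Hausdorff_imp_regular_space)
  qed
  obtain k where k: "interior (C k) \<noteq> {}"
    by (rule Baire_closed_cover[of C UNIV, OF disjI2[OF lc] closed open_UNIV UNIV_not_empty cover])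
  then obtain A where A: "A \<in> interior (C k)" by auto
  obtain N where N: "\<And>B. (\<And>n. n < N \<Longrightarrow> B n = A n) \<Longrightarrow> B \<in> C k"
    using open_nat_bool_cylinder[OF open_interior A] interior_subset by (metis subsetD)
  show "\<exists>N. \<forall>F. finite F \<longrightarrow> (\<forall>i\<in>F. N \<le> id i) \<longrightarrow> norm (sum a F) \<le> \<epsilon>"
  proof (intro exI[of _ N] allI impI)
    fix F :: "nat set" assume F: "finite F" "\<forall>i\<in>F. N \<le> id i"
    \<comment> \<open>Both \<open>B\<close> and \<open>B'\<close> belong to the cylinder, and their sums differ by \<open>sum a F\<close>.\<close>
    define B where "B n \<longleftrightarrow> n < N \<and> A n" for n
    define B' where "B' n \<longleftrightarrow> B n \<or> n \<in> F" for n
    have "n \<notin> F" if "n < N" for n using F(2) that by (auto simp: not_le)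
    then have B: "B \<in> C k" "B' \<in> C k" by (auto intro!: N simp: B_def B'_def)
    show "norm (sum a F) \<le> \<epsilon>"
    proof (rule ball)
      fix u assume "u \<in> Fs"
      then have u: "bounded_linear u" and le: "\<And>z. \<bar>u z\<bar> \<le> norm z" by (auto simp: Fs_def)
      have sm: "summable (\<lambda>n. if P n then u (a n) else 0)" for P
        by (rule summable_comparison_test'[OF abs[OF u], of 0]) auto
      have "u (x B') - u (x B) = (\<Sum>n. (if B' n then u (a n) else 0) - (if B n then u (a n) else 0))"
        unfolding x[OF u] by (rule suminf_diff[OF sm sm])
      also have "\<dots> = (\<Sum>n\<in>F. (if B' n then u (a n) else 0) - (if B n then u (a n) else 0))"
        by (rule suminf_finite[OF F(1)]) (auto simp: B'_def)
      also have "\<dots> = (\<Sum>n\<in>F. u (a n))"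
        by (rule sum.cong) (use F(2) in \<open>auto simp: B'_def B_def\<close>)
      also have "\<dots> = u (sum a F)" using u by (simp add: bounded_linear.linear linear_sum)
      finally have eq: "u (sum a F) = u (x B') - u (x B)" by simp
      have "u (x B') - u (x B) = u (x B' - q k) - u (x B - q k)"
        using u by (simp add: bounded_linear.linear linear_diff)
      then show "\<bar>u (sum a F)\<bar> \<le> \<epsilon>"
        using eq B le[of "x B' - q k"] le[of "x B - q k"] by (simp add: C_def)
    qed
  qed
qed

section \<open>Pettis integrals over disjoint intervals\<close>

text \<open>
  The weak sum over an index set \<open>A\<close> that the Orlicz-Pettis theorem asks for is the Pettis integral over
  the union of the intervals with index in \<open>A\<close>.
\<close>

lemma pettis_integrals_small_tails:
  fixes smul :: "'k::{real_normed_field,euclidean_space} \<Rightarrow> 'a::banach \<Rightarrow> 'a" and f :: "real \<Rightarrow> 'a"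
  assumes b: "banach_over smul" and sep: "separable_space (euclidean :: 'a topology)"
    and f: "pettis_integrable smul f"
    and disj: "\<And>i j. i \<noteq> j \<Longrightarrow> {c i..d i} \<inter> {c j..d j} = {}"
    and nonneg: "\<And>i :: nat. 0 \<le> c i" and cont: "\<And>i. continuous_on {c i..d i} f"
  shows "unconditionally_small_tails id (\<lambda>i. integral {c i..d i} f)"
proof (rule Orlicz_Pettis[OF sep])
  note int = pettis_integrable_real(1)[OF b f]
  have sub: "{c i..d i} \<subseteq> {0..}" for i using nonneg[of i] by auto
  have u_int: "u (integral {c i..d i} f) = (LINT t:{c i..d i}|lebesgue. u (f t))"
    if u: "bounded_linear u" for u :: "'a \<Rightarrow> real" and i
  proof -
    have "set_integrable lebesgue {c i..d i} (\<lambda>t. u (f t))"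
      by (rule set_integrable_subset[OF int[OF u] _ sub]) simp
    then have "(LINT t:{c i..d i}|lebesgue. u (f t)) = integral {c i..d i} (\<lambda>t. u (f t))"
      by (rule set_lebesgue_integral_eq_integral)
    also have "\<dots> = u (integral {c i..d i} f)"
      using integral_linear[OF integrable_continuous_interval[OF cont] u] by (simp add: o_def)
    finally show ?thesis by simp
  qed
  show "summable (\<lambda>i. \<bar>u (integral {c i..d i} f)\<bar>)" if u: "bounded_linear u" for u :: "'a \<Rightarrow> real"
  proof (rule bounded_imp_summable)
    fix n
    have abs_int: "set_integrable lebesgue {0..} (\<lambda>t. \<bar>u (f t)\<bar>)"
      by (rule set_integrable_abs[OF int[OF u]])
    have sub_int: "set_integrable lebesgue {c i..d i} (\<lambda>t. u (f t))" for i
      by (rule set_integrable_subset[OF int[OF u] _ sub]) simp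
    have sub_Un: "(\<Union>i\<in>{..n}. {c i..d i}) \<subseteq> {0..}" using sub by blast
    have "(\<Sum>i\<le>n. \<bar>u (integral {c i..d i} f)\<bar>) \<le> (\<Sum>i\<le>n. LINT t:{c i..d i}|lebesgue. \<bar>u (f t)\<bar>)"
      using set_integral_norm_bound[OF sub_int] by (intro sum_mono) (simp add: u_int[OF u])
    also have "\<dots> = (LINT t:(\<Union>i\<in>{..n}. {c i..d i})|lebesgue. \<bar>u (f t)\<bar>)"
    proof (rule set_integral_finite_Union[symmetric])
      show "disjoint_family_on (\<lambda>i. {c i..d i}) {..n}"
        using disj by (simp add: disjoint_family_on_def)
    qed (use set_integrable_abs[OF sub_int] in auto)
    also have "\<dots> \<le> (LINT t:{0..}|lebesgue. \<bar>u (f t)\<bar>)"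
      unfolding set_lebesgue_integral_def
    proof (rule integral_mono)
      have "set_integrable lebesgue (\<Union>i\<in>{..n}. {c i..d i}) (\<lambda>t. \<bar>u (f t)\<bar>)"
        by (rule set_integrable_subset[OF abs_int _ sub_Un]) auto
      then show "integrable lebesgue (\<lambda>t. indicator (\<Union>i\<in>{..n}. {c i..d i}) t *\<^sub>R \<bar>u (f t)\<bar>)"
        by (simp add: set_integrable_def)
      show "integrable lebesgue (\<lambda>t. indicator {0..} t *\<^sub>R \<bar>u (f t)\<bar>)"
        using abs_int by (simp add: set_integrable_def)
      show "indicator (\<Union>i\<in>{..n}. {c i..d i}) t *\<^sub>R \<bar>u (f t)\<bar> \<le> indicator {0..} t *\<^sub>R \<bar>u (f t)\<bar>" for t
        using sub_Un by (intro scaleR_right_mono indicator_leI) (blast, simp)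
    qed
    finally show "(\<Sum>i\<le>n. \<bar>u (integral {c i..d i} f)\<bar>) \<le> (LINT t:{0..}|lebesgue. \<bar>u (f t)\<bar>)" .
  qed simp
  show "\<exists>x. \<forall>u :: 'a \<Rightarrow> real. bounded_linear u \<longrightarrow>
      u x = (\<Sum>n. if A n then u (integral {c n..d n} f) else 0)" for A
  proof -
    define I where "I n = (if A n then {c n..d n} else {})" for n
    have "I n \<subseteq> {0..}" for n by (cases "A n") (simp_all only: I_def if_True if_False sub empty_subsetI)
    then have "(\<Union>n. I n) \<subseteq> {0..}" by blast
    moreover have "(\<Union>n. I n) \<in> sets lebesgue" by (auto simp: I_def)
    ultimately have E: "(\<Union>n. I n) \<in> sets lebesgue" "(\<Union>n. I n) \<subseteq> {0..}" by blast+
    have "(LINT t:(\<Union>n. I n)|lebesgue. u (f t)) = (\<Sum>n. if A n then u (integral {c n..d n} f) else 0)"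
      if u: "bounded_linear u" for u :: "'a \<Rightarrow> real"
    proof -
      have "(LINT t:(\<Union>n. I n)|lebesgue. u (f t)) = (\<Sum>n. LINT t:I n|lebesgue. u (f t))"
      proof (rule lebesgue_integral_countable_add)
        show "I i \<inter> I j = {}" if "i \<noteq> j" for i j using disj[OF that] by (auto simp: I_def)
        show "set_integrable lebesgue (\<Union>n. I n) (\<lambda>t. u (f t))"
          by (rule set_integrable_subset[OF int[OF u] E])
      qed (simp add: I_def)
      also have "(\<lambda>n. LINT t:I n|lebesgue. u (f t)) = (\<lambda>n. if A n then u (integral {c n..d n} f) else 0)"
        by (rule ext) (simp add: I_def u_int[OF u] set_lebesgue_integral_def)
      finally show ?thesis .
    qed
    then show ?thesis using pettis_integrable_real(2)[OF b f E] by metis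
  qed
qed

section \<open>Complete orbits of the semigroup\<close>

lemma linear_continuous_imp_bounded_linear:
  fixes f :: "'a::real_normed_vector \<Rightarrow> 'b::real_normed_vector"
  assumes f: "linear f" and cont: "continuous_on UNIV f"
  shows "bounded_linear f"
proof -
  obtain d where d: "d > 0" "\<And>x. dist x 0 < d \<Longrightarrow> dist (f x) (f 0) < 1"
    using cont unfolding continuous_on_iff by (metis UNIV_I zero_less_one)
  have "norm (f x) \<le> norm x * (2 / d)" for x
  proof (cases "x = 0")
    case False
    define c where "c = d / (2 * norm x)"
    have c: "c > 0" using d False by (simp add: c_def)
    have "norm (c *\<^sub>R x) < d" using d False by (simp add: c_def)
    then have "norm (f (c *\<^sub>R x)) < 1" using d(2)[of "c *\<^sub>R x"] by (simp add: linear_0[OF f])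
    then have "c * norm (f x) < 1" using c by (simp add: linear_cmul[OF f])
    then show ?thesis using d False by (simp add: c_def field_simps)
  qed (simp add: linear_0[OF f])
  then show ?thesis
    using f by (intro bounded_linear_intro[of _ "2 / d"]) (auto simp: linear_add linear_cmul)
qed

lemma C0_semigroup_bounded_linear:
  assumes b: "banach_over smul" and C0: "C0_semigroup smul T" and t: "t \<ge> 0"
  shows "bounded_linear (T t)"
proof (rule linear_continuous_imp_bounded_linear)
  have lin: "Vector_Spaces.linear smul smul (T t)" and "continuous_on UNIV (T t)"
    using C0 t by (auto simp: C0_semigroup_def)
  then show "continuous_on UNIV (T t)" by simp
  interpret lin: Vector_Spaces.linear smul smul "T t" by (rule lin)
  show "linear (T t)"
    using lin.add lin.scale banach_over.scale_of_real[OF b] by (intro linearI) metis+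
qed

lemma small_tails_scaleR:
  assumes "unconditionally_small_tails h v"
  shows "unconditionally_small_tails h (\<lambda>i. c *\<^sub>R v i)"
  unfolding unconditionally_small_tails_def
proof (intro allI impI)
  fix \<epsilon> :: real assume e: "\<epsilon> > 0"
  then have "\<epsilon> / (\<bar>c\<bar> + 1) > 0" by simp
  then obtain N where N: "\<And>F. finite F \<Longrightarrow> (\<forall>i\<in>F. N \<le> h i) \<Longrightarrow> norm (sum v F) \<le> \<epsilon> / (\<bar>c\<bar> + 1)"
    using assms unfolding unconditionally_small_tails_def by meson
  show "\<exists>N. \<forall>F. finite F \<longrightarrow> (\<forall>i\<in>F. N \<le> h i) \<longrightarrow> norm (\<Sum>i\<in>F. c *\<^sub>R v i) \<le> \<epsilon>"
  proof (intro exI[of _ N] allI impI)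
    fix F assume "finite F" "\<forall>i\<in>F. N \<le> h i"
    from N[OF this] have "\<bar>c\<bar> * norm (sum v F) \<le> \<bar>c\<bar> * (\<epsilon> / (\<bar>c\<bar> + 1))"
      by (rule mult_left_mono) simp
    also have "\<dots> \<le> \<epsilon>" using e by (simp add: field_simps)
    finally show "norm (\<Sum>i\<in>F. c *\<^sub>R v i) \<le> \<epsilon>" by (simp flip: scaleR_sum_right)
  qed
qed

lemma small_tails_int:
  fixes v :: "int \<Rightarrow> 'a::real_normed_vector"
  assumes pos: "unconditionally_small_tails id (\<lambda>n. v (int n))"
    and neg: "unconditionally_small_tails id (\<lambda>n. v (- int n - 1))"
  shows "unconditionally_small_tails (\<lambda>j. nat \<bar>j\<bar>) v"
  unfolding unconditionally_small_tails_def
proof (intro allI impI)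
  fix \<epsilon> :: real assume "\<epsilon> > 0"
  then have e: "\<epsilon> / 2 > 0" by simp
  obtain N1 where N1: "\<And>F. finite F \<Longrightarrow> (\<forall>i\<in>F. N1 \<le> i) \<Longrightarrow> norm (\<Sum>n\<in>F. v (int n)) \<le> \<epsilon> / 2"
    using pos e unfolding unconditionally_small_tails_def id_def by meson
  obtain N2 where N2: "\<And>F. finite F \<Longrightarrow> (\<forall>i\<in>F. N2 \<le> i) \<Longrightarrow> norm (\<Sum>n\<in>F. v (- int n - 1)) \<le> \<epsilon> / 2"
    using neg e unfolding unconditionally_small_tails_def id_def by meson
  show "\<exists>N. \<forall>F. finite F \<longrightarrow> (\<forall>j\<in>F. N \<le> nat \<bar>j\<bar>) \<longrightarrow> norm (sum v F) \<le> \<epsilon>"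
  proof (intro exI[of _ "N1 + N2 + 1"] allI impI)
    fix F :: "int set" assume F: "finite F" "\<forall>j\<in>F. N1 + N2 + 1 \<le> nat \<bar>j\<bar>"
    define P where "P = {j\<in>F. 0 \<le> j}"
    define Q where "Q = {j\<in>F. j < 0}"
    have split: "sum v F = sum v P + sum v Q"
      using F(1) by (subst sum.union_disjoint[symmetric]) (auto simp: P_def Q_def intro!: sum.cong)
    have "sum v P = (\<Sum>n\<in>nat ` P. v (int n))"
      by (subst sum.reindex) (auto simp: inj_on_def P_def)
    moreover have "norm (\<Sum>n\<in>nat ` P. v (int n)) \<le> \<epsilon> / 2"
      by (rule N1) (use F in \<open>auto simp: P_def\<close>)
    moreover have "sum v Q = (\<Sum>n\<in>(\<lambda>j. nat (- j - 1)) ` Q. v (- int n - 1))"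
      by (subst sum.reindex) (auto simp: inj_on_def Q_def)
    moreover have "norm (\<Sum>n\<in>(\<lambda>j. nat (- j - 1)) ` Q. v (- int n - 1)) \<le> \<epsilon> / 2"
      by (rule N2) (use F in \<open>auto simp: Q_def\<close>)
    ultimately show "norm (sum v F) \<le> \<epsilon>"
      using norm_triangle_ineq[of "sum v P" "sum v Q"] split by simp
  qed
qed

text \<open>
  The vectors are averages over \<open>{j..j + \<delta>}\<close> of the two-sided orbit \<open>G\<close> of \<open>x\<close>. The curve \<open>G\<close> is
  continuous everywhere, also at \<open>0\<close>, because to the right of any \<open>c\<close> it is the forward orbit of \<open>G c\<close>.
  The intervals with \<open>j < 0\<close> lie in the negative half-line, where \<open>G\<close> is the reflected \<open>S\<close>.
\<close>

lemma complete_orbit_small_tails: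
  fixes smul :: "'k::{real_normed_field,euclidean_space} \<Rightarrow> 'a::banach \<Rightarrow> 'a"
  assumes b: "banach_over smul" and sep: "separable_space (euclidean :: 'a topology)"
    and C0: "C0_semigroup smul T"
    and TS: "\<And>t. t > 0 \<Longrightarrow> T t (S t x) = x"
    and TS': "\<And>t r. t > 0 \<Longrightarrow> r > t \<Longrightarrow> T t (S r x) = S (r - t) x"
    and pT: "pettis_integrable smul (\<lambda>t. T t x)" and pS: "pettis_integrable smul (\<lambda>t. S t x)"
    and e: "\<epsilon> > 0"
  shows "\<exists>v. (\<forall>m j. T (real m) (v j) = v (j + int m)) \<and>
    unconditionally_small_tails (\<lambda>j. nat \<bar>j\<bar>) v \<and> norm (v 0 - x) < \<epsilon>"
proof -
  have T0: "T 0 y = y" for y using C0 by (simp add: C0_semigroup_def)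
  have Tadd: "T (s + t) y = T s (T t y)" if "s \<ge> 0" "t \<ge> 0" for s t y
    using C0 that by (simp add: C0_semigroup_def)
  have Tcont: "continuous_on {0..} (\<lambda>t. T t y)" for y using C0 by (simp add: C0_semigroup_def)
  define G where "G t = (if t \<ge> 0 then T t x else S (- t) x)" for t
  have shift: "T s (G t) = G (t + s)" if "s \<ge> 0" for s t
  proof (cases "s = 0 \<or> t \<ge> 0")
    case True
    then show ?thesis using that by (auto simp: G_def T0 add.commute simp flip: Tadd)
  next
    case False
    then have st: "s > 0" "t < 0" using that by auto
    show ?thesis
    proof (cases "t + s \<ge> 0")
      case True
      then have "T s (S (- t) x) = T (t + s) (T (- t) (S (- t) x))"
        using st Tadd[of "t + s" "- t"] by simp
      then show ?thesis using st True TS[of "- t"] by (simp add: G_def)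
    next
      case False
      moreover have "- t - s = - (t + s)" by simp
      ultimately show ?thesis using st TS'[of s "- t"] by (simp only: G_def) simp
    qed
  qed
  have Gcont: "continuous_on {c..d} G" for c d
  proof -
    have "continuous_on {c..d} (\<lambda>t. T (t - c) (G c))"
      by (rule continuous_on_compose2[OF Tcont]) (auto intro!: continuous_intros)
    then show ?thesis by (rule continuous_on_eq) (simp add: shift)
  qed
  obtain \<delta> where \<delta>: "0 < \<delta>" "\<delta> < 1" and close: "\<And>t. t \<in> {0..\<delta>} \<Longrightarrow> norm (G t - x) \<le> \<epsilon> / 2"
  proof -
    have "\<exists>d>0. \<forall>t\<in>{0..1}. dist t 0 < d \<longrightarrow> dist (G t) (G 0) < \<epsilon> / 2"
      using Gcont[of 0 1] e unfolding continuous_on_iff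
      by (metis atLeastAtMost_iff half_gt_zero order_refl zero_le_one)
    then obtain d where d: "d > 0" "\<And>t. t \<in> {0..1} \<Longrightarrow> dist t 0 < d \<Longrightarrow> dist (G t) (G 0) < \<epsilon> / 2"
      by blast
    show thesis
    proof (rule that[of "min (d / 2) (1 / 2)"])
      fix t assume "t \<in> {0..min (d / 2) (1 / 2)}"
      then have "dist (G t) (G 0) < \<epsilon> / 2" using d(1) by (intro d(2)) (auto simp: dist_real_def)
      then show "norm (G t - x) \<le> \<epsilon> / 2" by (simp add: dist_norm G_def T0)
    qed (use d in auto)
  qed
  define v where "v j = (1 / \<delta>) *\<^sub>R integral {real_of_int j..real_of_int j + \<delta>} G" for j
  have "T (real m) (v j) = v (j + int m)" for m j
  proof -
    have bl: "bounded_linear (T (real m))" by (rule C0_semigroup_bounded_linear[OF b C0]) simp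
    have "T (real m) (integral {real_of_int j..real_of_int j + \<delta>} G)
        = integral {real_of_int j..real_of_int j + \<delta>} (\<lambda>t. T (real m) (G t))"
      using integral_linear[OF integrable_continuous_interval[OF Gcont] bl] by (simp add: o_def)
    also have "\<dots> = integral {real_of_int j..real_of_int j + \<delta>} (G \<circ> (+) (real m))"
      by (simp add: shift o_def add.commute)
    also have "\<dots> = integral {real_of_int j + real m..real_of_int j + real m + \<delta>} G"
      by (simp add: integral_shift_Icc_real add_ac)
    finally show ?thesis by (simp add: v_def linear_cmul bounded_linear.linear[OF bl])
  qed
  moreover have "unconditionally_small_tails (\<lambda>j. nat \<bar>j\<bar>) v"
  proof (rule small_tails_int)
    have disj: "{real i + s..real i + s + \<delta>} \<inter> {real j + s..real j + s + \<delta>} = {}" if "i \<noteq> j" for i j s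
    proof -
      have "real i + 1 \<le> real j \<or> real j + 1 \<le> real i" using that by linarith
      then show ?thesis using \<delta> by auto
    qed
    have "unconditionally_small_tails id (\<lambda>i. integral {real i + 0..real i + 0 + \<delta>} (\<lambda>t. T t x))"
      by (rule pettis_integrals_small_tails[OF b sep pT disj])
        (auto intro: continuous_on_subset[OF Tcont])
    moreover have "integral {real i + 0..real i + 0 + \<delta>} (\<lambda>t. T t x) = integral {real i..real i + \<delta>} G" for i
      unfolding add_0_right by (rule integral_cong) (simp add: G_def)
    ultimately show "unconditionally_small_tails id (\<lambda>n. v (int n))"
      by (simp add: v_def small_tails_scaleR)
    \<comment> \<open>Reflection maps \<open>{- i - 1..- i - 1 + \<delta>}\<close> to \<open>{i + 1 - \<delta>..i + 1}\<close>, which avoids \<open>0\<close> since \<open>\<delta> < 1\<close>.\<close>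
    have "unconditionally_small_tails id
        (\<lambda>i. integral {real i + (1 - \<delta>)..real i + (1 - \<delta>) + \<delta>} (\<lambda>t. S t x))"
    proof (rule pettis_integrals_small_tails[OF b sep pS disj])
      fix i
      have "continuous_on {real i + (1 - \<delta>)..real i + (1 - \<delta>) + \<delta>} (\<lambda>t. G (- t))"
        by (rule continuous_on_compose2[OF Gcont[of "- (real i + 1)" 0]])
          (use \<delta> in \<open>auto intro!: continuous_intros\<close>)
      then show "continuous_on {real i + (1 - \<delta>)..real i + (1 - \<delta>) + \<delta>} (\<lambda>t. S t x)"
        by (rule continuous_on_eq) (use \<delta> in \<open>auto simp: G_def\<close>)
    qed (use \<delta> in auto)
    moreover have "integral {real i + (1 - \<delta>)..real i + (1 - \<delta>) + \<delta>} (\<lambda>t. S t x)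
        = integral {- real i - 1..- real i - 1 + \<delta>} G" for i
    proof -
      have "integral {real i + (1 - \<delta>)..real i + (1 - \<delta>) + \<delta>} (\<lambda>t. S t x)
          = integral {- (real i + (1 - \<delta>) + \<delta>)..- (real i + (1 - \<delta>))} (\<lambda>t. S (- t) x)"
        by (rule Henstock_Kurzweil_Integration.integral_reflect_real[symmetric])
      also have "\<dots> = integral {- (real i + (1 - \<delta>) + \<delta>)..- (real i + (1 - \<delta>))} G"
        by (rule integral_cong) (use \<delta> in \<open>auto simp: G_def\<close>)
      also have "- (real i + (1 - \<delta>) + \<delta>) = - real i - 1" by simp
      also have "- (real i + (1 - \<delta>)) = - real i - 1 + \<delta>" by simp
      finally show ?thesis .
    qed
    ultimately show "unconditionally_small_tails id (\<lambda>n. v (- int n - 1))"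
      by (simp add: v_def small_tails_scaleR)
  qed
  moreover have "norm (v 0 - x) < \<epsilon>"
  proof -
    have "integral {0..\<delta>} (\<lambda>t. G t - x) = integral {0..\<delta>} G - \<delta> *\<^sub>R x"
      using \<delta> by (subst integral_diff) (auto intro: integrable_continuous_interval Gcont)
    then have "v 0 - x = (1 / \<delta>) *\<^sub>R integral {0..\<delta>} (\<lambda>t. G t - x)"
      using \<delta> by (simp add: v_def scaleR_diff_right)
    moreover have "norm (integral {0..\<delta>} (\<lambda>t. G t - x)) \<le> \<epsilon> / 2 * (\<delta> - 0)"
      by (rule integral_bound) (use \<delta> close in \<open>auto intro!: continuous_intros Gcont\<close>)
    ultimately have "norm (v 0 - x) \<le> \<epsilon> / 2" using \<delta> by (simp add: field_simps)
    with e show ?thesis by simp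
  qed
  ultimately show ?thesis by blast
qed


section \<open>Separated sequences and a frequently visiting vector\<close>

text \<open>
  Enumerate the places \<open>p 0 < p 1 < \<dots>\<close> so that \<open>p j\<close> keeps distance \<open>g j\<close> from all others, and let the
  \<open>l\<close>-th sequence occupy the indices \<open>D l + i * D (Suc l)\<close>. With \<open>D l dvd D (Suc l)\<close> these index sets
  are disjoint, for all their members are multiples of \<open>D l\<close> and none of \<open>D (Suc l)\<close>. So it is enough
  that \<open>g j \<ge> N l\<close> whenever \<open>D l dvd j\<close>. If \<open>D l \<ge> 2 ^ l * N l\<close>, the distances \<open>N l\<close> required at the
  multiples of \<open>D l\<close> cost on average at most \<open>(1/2) ^ l\<close> per index, so that \<open>p\<close> grows linearly.
\<close>

lemma separated_sequences:
  fixes N :: "nat \<Rightarrow> nat"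
  obtains a :: "nat \<Rightarrow> nat \<Rightarrow> nat"
  where "\<And>l. strict_mono (a l)" "\<And>l. \<exists>c. \<forall>i. a l i \<le> c * (i + 1)" "\<And>l i. N l \<le> a l i"
    "\<And>l i k j. (l, i) \<noteq> (k, j) \<Longrightarrow> N l \<le> nat \<bar>int (a l i) - int (a k j)\<bar>"
proof -
  define D where "D l = (\<Prod>i\<le>l. 2 * (N i + 1))" for l
  have D_Suc: "D (Suc l) = D l * (2 * (N (Suc l) + 1))" for l by (simp add: D_def)
  have D_pos: "D l > 0" for l by (simp add: D_def prod_pos)
  have D_less: "D l < D (Suc l)" for l using D_pos[of l] by (simp add: D_Suc)
  have D_dvd: "D l dvd D k" if "l \<le> k" for l k
    unfolding D_def by (rule prod_dvd_prod_subset) (use that in auto)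
  have D_ge: "2 ^ l * (N l + 1) \<le> D l" for l
  proof (induction l)
    case (Suc l)
    have "2 ^ l \<le> D l" using Suc by (metis add.commute le_add1 mult_le_mono2 mult.right_neutral order_trans)
    then have "2 ^ l * (2 * (N (Suc l) + 1)) \<le> D (Suc l)" unfolding D_Suc by (rule mult_le_mono1)
    then show ?case by (simp add: mult_ac)
  qed (simp add: D_def)
  have D_gt: "l < D l" for l
  proof -
    have "l < 2 ^ l" by simp
    also have "2 ^ l \<le> 2 ^ l * (N l + 1)" by simp
    also have "\<dots> \<le> D l" by (rule D_ge)
    finally show ?thesis .
  qed
  define g where "g j = 1 + (\<Sum>l<j. if D l dvd j then N l else 0)" for j
  have g_ge: "N l \<le> g j" if "D l dvd j" "j > 0" for l j
  proof -
    have "l < j" using D_gt[of l] dvd_imp_le[OF that] by simp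
    then have "(if D l dvd j then N l else 0) \<le> (\<Sum>l<j. if D l dvd j then N l else 0)"
      by (intro member_le_sum) auto
    then show ?thesis using that by (simp add: g_def)
  qed
  have g_sum: "(\<Sum>j=1..J. g j) \<le> 3 * J" for J
  proof -
    have multiples: "(\<Sum>j=1..J. if d dvd j then c else 0) = c * (J div d)" if "d > 0" for c d
    proof -
      have "{j\<in>{1..J}. d dvd j} = (*) d ` {1..J div d}"
        using that by (auto simp: dvd_def less_eq_div_iff_mult_less_eq mult.commute image_iff Suc_le_eq)
      then have "card {j\<in>{1..J}. d dvd j} = J div d"
        using that by (simp add: card_image inj_on_def)
      moreover have "(\<Sum>j=1..J. if d dvd j then c else 0) = (\<Sum>j\<in>{j\<in>{1..J}. d dvd j}. c)"
        by (rule sum.inter_filter[symmetric]) simp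
      ultimately show ?thesis by (simp only: sum_constant of_nat_id mult.commute)
    qed
    have "(\<Sum>j=1..J. \<Sum>l<j. if D l dvd j then N l else 0) \<le> (\<Sum>j=1..J. \<Sum>l<J. if D l dvd j then N l else 0)"
      by (intro sum_mono sum_mono2) auto
    also have "\<dots> = (\<Sum>l<J. \<Sum>j=1..J. if D l dvd j then N l else 0)" by (rule sum.swap)
    also have "\<dots> = (\<Sum>l<J. N l * (J div D l))"
      by (intro sum.cong refl multiples D_pos)
    finally have "real (\<Sum>j=1..J. \<Sum>l<j. if D l dvd j then N l else 0) \<le> (\<Sum>l<J. real (N l * (J div D l)))"
      by (simp only: of_nat_le_iff flip: of_nat_sum)
    also have "\<dots> \<le> (\<Sum>l<J. real J * (1/2) ^ l)"
    proof (rule sum_mono)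
      fix l
      have "(2 ^ l * N l) * (J div D l) \<le> D l * (J div D l)"
        using D_ge[of l] by (intro mult_le_mono1) (simp add: algebra_simps)
      also have "\<dots> \<le> J" by simp
      finally have "real (2 ^ l * N l * (J div D l)) \<le> real J" by (rule of_nat_mono)
      then show "real (N l * (J div D l)) \<le> real J * (1/2) ^ l"
        by (simp add: field_simps power_divide)
    qed
    also have "\<dots> = real J * (\<Sum>l<J. (1/2) ^ l)" by (simp add: sum_distrib_left)
    also have "\<dots> \<le> real J * 2"
    proof (rule mult_left_mono)
      have "(\<Sum>l<J. (1/2 :: real) ^ l) = 2 - 2 * (1/2) ^ J" by (induction J) simp_all
      then show "(\<Sum>l<J. (1/2 :: real) ^ l) \<le> 2" by simp
    qed simp
    finally have "(\<Sum>j=1..J. \<Sum>l<j. if D l dvd j then N l else 0) \<le> 2 * J" by linarith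
    then show ?thesis by (simp add: g_def sum_Suc)
  qed
  define p where "p j = (\<Sum>i\<le>j. g i) + (\<Sum>i<j. g i)" for j
  have p_gap: "p i + g i + g j \<le> p j" if "i < j" for i j
    using that
  proof (induction j)
    case (Suc j)
    have "p (Suc j) = p j + g j + g (Suc j)"
      by (simp add: p_def lessThan_Suc_atMost[symmetric])
    moreover have "i = j \<or> p i + g i + g j \<le> p j" using Suc by (auto simp: less_Suc_eq)
    ultimately show ?case by auto
  qed simp
  have p_ge: "g j \<le> p j" for j by (simp add: p_def member_le_sum trans_le_add1)
  have p_le: "p j \<le> 8 * j" if "j > 0" for j
  proof -
    have "(\<Sum>i<j. g i) \<le> (\<Sum>i\<le>j. g i)" by (intro sum_mono2) auto
    moreover have "(\<Sum>i\<le>j. g i) = g 0 + (\<Sum>i=1..j. g i)"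
      by (simp add: sum.atMost_shift atLeast0AtMost sum.atLeast1_atMost_eq lessThan_Suc_atMost)
    moreover have "g 0 = 1" by (simp add: g_def)
    ultimately show ?thesis using g_sum[of j] that by (simp add: p_def)
  qed
  define r where "r l i = D l + i * D (Suc l)" for l i
  have r_pos: "r l i > 0" for l i using D_pos[of l] by (simp add: r_def)
  have r_dvd: "D l dvd r l i" for l i using D_dvd[of l "Suc l"] by (simp add: r_def)
  have r_neq: "r l i \<noteq> r k j" if "l < k" for l k i j
  proof
    assume eq: "r l i = r k j"
    have "D (Suc l) dvd r k j" using D_dvd[of "Suc l" k] r_dvd that by (meson Suc_leI dvd_trans)
    then have "D (Suc l) dvd D l + i * D (Suc l)" unfolding eq[symmetric] unfolding r_def .
    then have "D (Suc l) dvd D l" by (simp only: dvd_add_times_triv_right_iff)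
    then show False using nat_dvd_not_less[OF D_pos D_less] by blast
  qed
  have r_inj: "r l i \<noteq> r k j" if "(l, i) \<noteq> (k, j)" for l i k j
  proof (cases "l = k")
    case True
    then show ?thesis using that D_pos[of "Suc l"] by (simp add: r_def)
  next
    case False
    then show ?thesis using r_neq[of l k i j] r_neq[of k l j i] by (metis linorder_neqE_nat)
  qed
  show thesis
  proof
    show "strict_mono (\<lambda>i. p (r l i))" for l
    proof (rule strict_monoI)
      fix i j :: nat assume "i < j"
      then have "r l i < r l j" using D_pos[of "Suc l"] by (simp add: r_def)
      from p_gap[OF this] show "p (r l i) < p (r l j)" by (simp add: g_def)
    qed
    show "\<exists>c. \<forall>i. p (r l i) \<le> c * (i + 1)" for l
    proof (intro exI allI)
      fix i
      have "p (r l i) \<le> 8 * r l i" by (rule p_le[OF r_pos])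
      also have "r l i \<le> D (Suc l) * (i + 1)" using D_less[of l] by (simp add: r_def algebra_simps)
      finally show "p (r l i) \<le> (8 * D (Suc l)) * (i + 1)" by simp
    qed
    show "N l \<le> p (r l i)" for l i
      using g_ge[OF r_dvd r_pos] p_ge order_trans by blast
    show "N l \<le> nat \<bar>int (p (r l i)) - int (p (r k j))\<bar>" if "(l, i) \<noteq> (k, j)" for l i k j
    proof -
      have "r l i < r k j \<or> r k j < r l i" using r_inj[OF that] by linarith
      then show ?thesis
        using p_gap[of "r l i" "r k j"] p_gap[of "r k j" "r l i"] g_ge[OF r_dvd[of l i] r_pos]
        by linarith
    qed
  qed
qed

text \<open>
  Let \<open>x = (\<Sum>k. \<Sum>i. v k (- a k i))\<close> and \<open>m = a l i0\<close>. Then \<open>T m x - v l 0\<close> consists of the terms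
  \<open>v k (m - a k i)\<close> with \<open>(k, i) \<noteq> (l, i0)\<close>, and for fixed \<open>k\<close> the integers \<open>m - a k i\<close> are distinct
  and at least as large as \<open>N k\<close> and \<open>N l\<close> in absolute value. The thresholds \<open>N\<close> are chosen such that
  the part with index \<open>k\<close> has norm at most \<open>(1/4) ^ max k l \<le> (1/2) ^ k * (1/2) ^ l\<close>, which can be
  summed over \<open>k\<close>.
\<close>

lemma frequently_visiting_vector:
  fixes v :: "nat \<Rightarrow> int \<Rightarrow> 'a::banach" and T :: "nat \<Rightarrow> 'a \<Rightarrow> 'a"
  assumes T: "\<And>m. bounded_linear (T m)"
    and orbit: "\<And>m l j. T m (v l j) = v l (j + int m)"
    and tails: "\<And>l. unconditionally_small_tails (\<lambda>j. nat \<bar>j\<bar>) (v l)"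
  obtains x a where "\<And>l. strict_mono (a l)" "\<And>l. \<exists>c. \<forall>i. a l i \<le> c * (i + 1)"
    "\<And>l i. norm (T (a l i) x - v l 0) \<le> 2 * (1/2) ^ l"
proof -
  have "\<exists>N. \<forall>F. finite F \<longrightarrow> (\<forall>j\<in>F. N \<le> nat \<bar>j\<bar>) \<longrightarrow> norm (sum (v k) F) \<le> (1/4) ^ l" for k l
    using tails[of k] unfolding unconditionally_small_tails_def by simp
  then obtain M where M: "\<And>k l F. finite F \<Longrightarrow> (\<And>j. j \<in> F \<Longrightarrow> M k l \<le> nat \<bar>j\<bar>) \<Longrightarrow>
      norm (sum (v k) F) \<le> (1/4) ^ l"
    by metis
  \<comment> \<open>One threshold serves all \<open>k \<le> l\<close> at once; the sum is a cheap upper bound for the maximum.\<close>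
  define N where "N l = (\<Sum>k\<le>l. M k l)" for l
  have M_le: "M k l \<le> N l" if "k \<le> l" for k l
    unfolding N_def by (rule member_le_sum) (use that in auto)
  have small: "norm (sum (v k) F) \<le> (1/2) ^ k * (1/2) ^ l"
    if "finite F" "\<And>j. j \<in> F \<Longrightarrow> N k \<le> nat \<bar>j\<bar>" "\<And>j. j \<in> F \<Longrightarrow> N l \<le> nat \<bar>j\<bar>" for k l F
  proof -
    have "norm (sum (v k) F) \<le> (1/4) ^ max k l"
    proof (cases "k \<le> l")
      case True
      then show ?thesis using M[of F k l] that M_le[of k l] by (fastforce simp: max_def)
    next
      case False
      then show ?thesis using M[of F k k] that M_le[of k k] by (fastforce simp: max_def)
    qed
    also have "\<dots> = (1/2) ^ (2 * max k l)" by (simp add: power_mult power2_eq_square)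
    also have "\<dots> \<le> (1/2) ^ (k + l)" by (rule power_decreasing) auto
    finally show ?thesis by (simp add: power_add)
  qed
  obtain a where mono: "\<And>l. strict_mono (a l)" and lin: "\<And>l. \<exists>c. \<forall>i. a l i \<le> c * (i + 1)"
    and ge: "\<And>l i. N l \<le> a l i"
    and sep: "\<And>l i k j. (l, i) \<noteq> (k, j) \<Longrightarrow> N l \<le> nat \<bar>int (a l i) - int (a k j)\<bar>"
    using separated_sequences[of N] by metis
  have a_inj: "inj_on (\<lambda>i. c - int (a k i)) I" for c k I
    using strict_mono_eq[OF mono[of k]] by (auto simp: inj_on_def)
  have sum_a: "(\<Sum>i\<in>I. v k (c - int (a k i))) = sum (v k) ((\<lambda>i. c - int (a k i)) ` I)" for c k I
    by (simp add: sum.reindex[OF a_inj])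
  define x where "x k = (\<Sum>i. v k (0 - int (a k i)))" for k
  have "summable (\<lambda>i. v k (0 - int (a k i)))" for k
    unfolding summable_Cauchy
  proof (intro allI impI)
    fix e :: real assume "e > 0"
    then obtain n where n: "\<And>F. finite F \<Longrightarrow> (\<And>j. j \<in> F \<Longrightarrow> n \<le> nat \<bar>j\<bar>) \<Longrightarrow> norm (sum (v k) F) \<le> e / 2"
      using tails[of k] unfolding unconditionally_small_tails_def by (meson half_gt_zero)
    have "norm (\<Sum>i=i0..<i1. v k (0 - int (a k i))) < e" if "n \<le> i0" for i0 i1
    proof -
      have "norm (\<Sum>i=i0..<i1. v k (0 - int (a k i))) \<le> e / 2"
        unfolding sum_a
        by (rule n) (use that strict_mono_imp_increasing[OF mono[of k]] order_trans in fastforce)+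
      with \<open>e > 0\<close> show ?thesis by simp
    qed
    then show "\<exists>n. \<forall>i0\<ge>n. \<forall>i1. norm (\<Sum>i=i0..<i1. v k (0 - int (a k i))) < e" by blast
  qed
  then have x_sums: "(\<lambda>i. v k (0 - int (a k i))) sums x k" for k
    unfolding x_def by (rule summable_sums)
  have "norm (x k) \<le> (1/2) ^ k" for k
  proof (rule Lim_norm_ubound[OF _ x_sums[unfolded sums_def]])
    show "\<forall>\<^sub>F n in sequentially. norm (\<Sum>i<n. v k (0 - int (a k i))) \<le> (1/2) ^ k"
    proof (intro always_eventually allI)
      fix n
      have "norm (\<Sum>i<n. v k (0 - int (a k i))) \<le> (1/2) ^ k * (1/2) ^ k"
        unfolding sum_a by (rule small) (use ge[of k] in auto)
      also have "\<dots> \<le> (1/2) ^ k" by (simp add: mult_le_cancel_left2 power_le_one)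
      finally show "norm (\<Sum>i<n. v k (0 - int (a k i))) \<le> (1/2) ^ k" .
    qed
  qed simp
  then have "summable x"
    by (intro summable_comparison_test'[of "\<lambda>k. (1/2::real) ^ k" 0 x]) auto
  then have X: "x sums suminf x" by (rule summable_sums)
  have est: "norm (T (a l i0) (suminf x) - v l 0) \<le> 2 * (1/2) ^ l" for l i0
  proof -
    define m where "m = a l i0"
    define e where "e k = (if k = l then v l 0 else 0)" for k
    define d where "d k = T m (x k) - e k" for k
    have d_le: "norm (d k) \<le> (1/2) ^ k * (1/2) ^ l" for k
    proof -
      \<comment> \<open>The index of the term \<open>v l 0\<close>, which is the one that is subtracted.\<close>
      define J where "J = (if k = l then {i0} else {})"
      have "(\<lambda>i. v k (int m - int (a k i))) sums T m (x k)"
        using bounded_linear.sums[OF T x_sums] by (simp add: orbit)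
      then have "(\<lambda>n. (\<Sum>i<n. v k (int m - int (a k i))) - e k) \<longlonglongrightarrow> d k"
        unfolding sums_def d_def by (intro tendsto_intros)
      then show ?thesis
      proof (rule Lim_norm_ubound[rotated])
        show "\<forall>\<^sub>F n in sequentially. norm ((\<Sum>i<n. v k (int m - int (a k i))) - e k) \<le> (1/2) ^ k * (1/2) ^ l"
          using eventually_gt_at_top[of i0]
        proof eventually_elim
          case (elim n)
          have "(\<Sum>i<n. v k (int m - int (a k i))) - e k = (\<Sum>i\<in>{..<n} - J. v k (int m - int (a k i)))"
          proof (cases "k = l")
            case True
            then show ?thesis using elim
              by (simp add: J_def e_def sum_diff1 m_def)
          qed (simp add: J_def e_def)
          also have "norm \<dots> \<le> (1/2) ^ k * (1/2) ^ l"
            unfolding sum_a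
          proof (rule small)
            fix j assume "j \<in> (\<lambda>i. int m - int (a k i)) ` ({..<n} - J)"
            then obtain i where "i \<in> {..<n} - J" and j: "j = int (a l i0) - int (a k i)"
              by (auto simp: m_def)
            then have "(l, i0) \<noteq> (k, i)" by (auto simp: J_def)
            with j show "N k \<le> nat \<bar>j\<bar>" "N l \<le> nat \<bar>j\<bar>"
              using sep[of l i0 k i] sep[of k i l i0] by (auto simp: abs_minus_commute)
          qed simp
          finally show ?case .
        qed
      qed simp
    qed
    have "d sums (T m (suminf x) - v l 0)"
      unfolding d_def e_def
      by (intro sums_diff bounded_linear.sums[OF T X] sums_single)
    moreover have g: "(\<lambda>k. (1/2) ^ k * (1/2) ^ l) sums (2 * (1/2 :: real) ^ l)"
      using sums_mult2[OF geometric_sums[of "1/2::real"], of "(1/2)^l"] by simp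
    ultimately show ?thesis
      using norm_suminf_le[of d, OF d_le sums_summable[OF g]]
      by (simp add: sums_iff m_def)
  qed
  from that[OF mono lin est] show thesis .
qed

section \<open>From integer times to Lebesgue density\<close>

text \<open>
  Take a closed ball inside \<open>U\<close>, of radius \<open>r\<close> around \<open>y\<close>. Every point of the open ball stays in the
  closed ball under \<open>T s\<close> for short times \<open>s\<close>, so the closed sets of points that stay there during
  \<open>{0..\<eta> k}\<close> cover the open ball, and by Baire one of them has interior points. This takes the
  place of a uniform bound on the operators near time \<open>0\<close>.
\<close>

lemma semigroup_keeps_open_set_inside:
  fixes smul :: "'k::{real_normed_field,euclidean_space} \<Rightarrow> 'a::banach \<Rightarrow> 'a"
  assumes C0: "C0_semigroup smul T" and U: "open U" "U \<noteq> {}"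
  obtains V \<eta> where "open V" "V \<noteq> {}" "0 < \<eta>" "\<eta> < 1" "\<And>z s. z \<in> V \<Longrightarrow> 0 \<le> s \<Longrightarrow> s \<le> \<eta> \<Longrightarrow> T s z \<in> U"
proof -
  obtain y r where r: "r > 0" "cball y r \<subseteq> U"
    using U open_contains_cball by (metis ex_in_conv)
  define \<eta> where "\<eta> k = 1 / (real k + 2)" for k :: nat
  define C where "C k = (\<Inter>s\<in>{0..\<eta> k}. {z. dist y (T s z) \<le> r})" for k
  have closed: "closed (C k)" for k
    unfolding C_def
    by (intro closed_INT ballI closed_Collect_le continuous_intros)
      (use C0 in \<open>auto simp: C0_semigroup_def\<close>)
  have cover: "ball y r \<subseteq> (\<Union>k. C k)"
  proof
    fix z assume z: "z \<in> ball y r"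
    have "continuous_on {0..} (\<lambda>t. T t z)" and T0: "T 0 z = z" using C0 by (auto simp: C0_semigroup_def)
    moreover have "r - dist y z > 0" using z by simp
    ultimately obtain d where "d > 0"
      and "\<forall>t\<in>{0..}. dist t 0 < d \<longrightarrow> dist (T t z) (T 0 z) < r - dist y z"
      unfolding continuous_on_iff by (metis atLeast_iff order_refl)
    then have d: "d > 0" "\<And>t. t \<ge> 0 \<Longrightarrow> t < d \<Longrightarrow> dist (T t z) z < r - dist y z"
      by (simp_all add: dist_real_def T0)
    obtain k :: nat where "1 / d < real k" using reals_Archimedean2 by blast
    then have "\<eta> k < d" using d(1) by (simp add: \<eta>_def field_simps)
    then have "z \<in> C k"
      using d(2) by (fastforce simp: C_def dist_commute intro: order_trans[OF dist_triangle[of _ _ z]])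
    then show "z \<in> (\<Union>k. C k)" by blast
  qed
  have "ball y r \<noteq> {}" using r(1) by simp
  then obtain k where k: "interior (C k) \<noteq> {}"
    by (rule Baire_closed_cover[OF disjI1[OF completely_metrizable_space_euclidean] closed open_ball _ cover])
  show thesis
  proof (rule that[of "interior (C k)" "\<eta> k"])
    fix z s assume "z \<in> interior (C k)" "0 \<le> s" "s \<le> \<eta> k"
    then show "T s z \<in> U" using interior_subset r(2) by (fastforce simp: C_def)
  qed (use k in \<open>auto simp: \<eta>_def\<close>)
qed

text \<open>
  Since the points \<open>a i\<close> are distinct integers and \<open>\<eta> < 1\<close>, the intervals are disjoint, and by the
  growth bound at least about \<open>N / (c + 1)\<close> of them lie in \<open>{0..N}\<close>.
\<close>

lemma lower_density_positive:
  fixes a :: "nat \<Rightarrow> nat"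
  assumes M: "M \<in> sets lebesgue" and a: "strict_mono a" "\<And>i. a i \<le> c * (i + 1)"
    and \<eta>: "0 < \<eta>" "\<eta> < 1" and sub: "\<And>i. {real (a i)..real (a i) + \<eta>} \<subseteq> M"
  shows "lower_density M > 0"
proof -
  define C where "C = real c + 1"
  have C: "C > 0" by (simp add: C_def)
  have "\<eta> / (2 * C) \<le> measure lebesgue (M \<inter> {0..N}) / N" if N: "N \<ge> 2 * C + 2" for N
  proof -
    define n where "n = nat \<lfloor>(N - 1) / C\<rfloor>"
    have Nge: "(N - 1) / C \<ge> 0" using N C by simp
    then have n: "real n \<le> (N - 1) / C" "(N - 1) / C - 1 \<le> real n"
      unfolding n_def by linarith+
    have disj: "disjoint_family_on (\<lambda>i. {real (a i)..real (a i) + \<eta>}) {..<n}"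
    proof (unfold disjoint_family_on_def, intro ballI impI)
      fix i j :: nat assume "i \<noteq> j"
      then have "a i < a j \<or> a j < a i" using a(1) by (metis linorder_neqE_nat strict_mono_less)
      then have "real (a i) + 1 \<le> real (a j) \<or> real (a j) + 1 \<le> real (a i)" by linarith
      then show "{real (a i)..real (a i) + \<eta>} \<inter> {real (a j)..real (a j) + \<eta>} = {}"
        using \<eta> by auto
    qed
    have inside: "(\<Union>i<n. {real (a i)..real (a i) + \<eta>}) \<subseteq> M \<inter> {0..N}"
    proof -
      have "real (a i) + \<eta> \<le> N" if "i < n" for i
      proof -
        have "real (a i) \<le> real (c * (i + 1))" by (intro of_nat_mono a)
        also have "\<dots> \<le> C * real n" using that unfolding C_def of_nat_mult by (intro mult_mono) auto
        also have "\<dots> \<le> N - 1" using n(1) C by (simp add: field_simps)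
        finally show ?thesis using \<eta> by simp
      qed
      then show ?thesis using sub by fastforce
    qed
    have "\<eta> / (2 * C) \<le> (real n * \<eta>) / N"
    proof -
      have "N / (2 * C) \<le> (N - 1) / C - 1" using N C by (simp add: field_simps)
      then have "N / (2 * C) \<le> real n" using n(2) by linarith
      then have "N / (2 * C) * \<eta> \<le> real n * \<eta>" using \<eta> by (intro mult_right_mono) auto
      then show ?thesis using N C by (simp add: field_simps)
    qed
    also have "real n * \<eta> = (\<Sum>i<n. measure lebesgue {real (a i)..real (a i) + \<eta>})"
      using \<eta> by simp
    also have "\<dots> = measure lebesgue (\<Union>i<n. {real (a i)..real (a i) + \<eta>})"
      by (rule measure_finite_Union[symmetric, OF _ _ disj]) (auto simp: emeasure_lborel_Icc_eq)
    also have "\<dots> \<le> measure lebesgue (M \<inter> {0..N})"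
      by (rule measure_mono_fmeasurable[OF inside])
        (use M in \<open>auto simp: fmeasurable_Int_fmeasurable Int_commute[of M]\<close>)
    finally show ?thesis using N C by (simp add: divide_right_mono)
  qed
  then have "\<forall>\<^sub>F N in at_top. ereal (\<eta> / (2 * C)) \<le> ereal (measure lebesgue (M \<inter> {0..N}) / N)"
    by (auto intro: eventually_at_top_linorderI[of "2 * C + 2"])
  then have "ereal (\<eta> / (2 * C)) \<le> lower_density M"
    unfolding lower_density_def by (rule Liminf_bounded)
  moreover have "ereal (\<eta> / (2 * C)) > 0" using \<eta> C by simp
  ultimately show ?thesis by (metis order_less_le_trans)
qed


section \<open>The criterion for frequent hypercyclicity\<close>

theorem theorem2p2:
  fixes smul :: "'k::{real_normed_field,euclidean_space} \<Rightarrow> 'a::banach \<Rightarrow> 'a"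
    and T S :: "real \<Rightarrow> 'a \<Rightarrow> 'a"
    and X0 :: "'a set"
  assumes "banach_over smul"
    and "separable_space (euclidean :: 'a topology)"
    and "C0_semigroup smul T"
    and "closure X0 = UNIV"
    and "\<And>x t. x \<in> X0 \<Longrightarrow> t > 0 \<Longrightarrow> T t (S t x) = x"
    and "\<And>x t r. x \<in> X0 \<Longrightarrow> t > 0 \<Longrightarrow> r > t \<Longrightarrow> T t (S r x) = S (r - t) x"
    and "\<And>x. x \<in> X0 \<Longrightarrow> pettis_integrable smul (\<lambda>t. T t x)"
    and "\<And>x. x \<in> X0 \<Longrightarrow> pettis_integrable smul (\<lambda>t. S t x)"
  shows "frequently_hypercyclic T"
proof -
  obtain D :: "'a set" where D: "countable D" "closure D = UNIV"
    using assms(2) unfolding separable_space_def by auto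
  then have "D \<noteq> {}" by auto
  then obtain q :: "nat \<Rightarrow> 'a" where q: "range q = D"
    using D(1) uncountable_def by metis
  \<comment> \<open>The pairing function makes every point of the dense sequence a target for infinitely many \<open>l\<close>.\<close>
  define target where "target l = q (fst (prod_decode l))" for l
  have "\<exists>v. (\<forall>m j. T (real m) (v j) = v (j + int m)) \<and>
      unconditionally_small_tails (\<lambda>j. nat \<bar>j\<bar>) v \<and> norm (v 0 - target l) < 1 / (real l + 1)" for l
  proof -
    have e: "1 / (2 * (real l + 1)) > 0" by simp
    have "target l \<in> closure X0" using assms(4) by simp
    then obtain x where x: "x \<in> X0" "dist x (target l) < 1 / (2 * (real l + 1))"
      using e unfolding closure_approachable by blast
    obtain v where "\<forall>m j. T (real m) (v j) = v (j + int m)"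
      "unconditionally_small_tails (\<lambda>j. nat \<bar>j\<bar>) v" "norm (v 0 - x) < 1 / (2 * (real l + 1))"
      using complete_orbit_small_tails[where T = T and S = S and x = x, OF assms(1-3) assms(5)[OF x(1)] assms(6)[OF x(1)]
          assms(7)[OF x(1)] assms(8)[OF x(1)] e] by blast
    moreover have "norm (v 0 - target l) \<le> norm (v 0 - x) + norm (x - target l)"
      using norm_triangle_ineq[of "v 0 - x" "x - target l"] by simp
    moreover have "1 / (2 * (real l + 1)) + 1 / (2 * (real l + 1)) = 1 / (real l + 1)"
      by (simp add: field_simps)
    ultimately show ?thesis using x(2) by (intro exI[of _ v]) (auto simp: dist_norm)
  qed
  then obtain v where orbit: "\<And>l m j. T (real m) (v l j) = v l (j + int m)"
    and tails: "\<And>l. unconditionally_small_tails (\<lambda>j. nat \<bar>j\<bar>) (v l)"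
    and near: "\<And>l. norm (v l 0 - target l) < 1 / (real l + 1)"
    by metis
  have bl: "bounded_linear (T (real m))" for m
    by (rule C0_semigroup_bounded_linear[OF assms(1,3)]) simp
  obtain x a where a: "\<And>l. strict_mono (a l)" "\<And>l. \<exists>c. \<forall>i. a l i \<le> c * (i + 1)"
    and visit: "\<And>l i. norm (T (real (a l i)) x - v l 0) \<le> 2 * (1/2) ^ l"
    using frequently_visiting_vector[of "\<lambda>m. T (real m)" v, OF bl orbit tails] by metis
  have "lower_density {t. 0 \<le> t \<and> T t x \<in> U} > 0" if U: "open U" "U \<noteq> {}" for U
  proof -
    obtain V \<eta> where V: "open V" "V \<noteq> {}" and \<eta>: "0 < \<eta>" "\<eta> < 1"
      and VU: "\<And>z s. z \<in> V \<Longrightarrow> 0 \<le> s \<Longrightarrow> s \<le> \<eta> \<Longrightarrow> T s z \<in> U"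
      using semigroup_keeps_open_set_inside[OF assms(3) U] by metis
    obtain z r where r: "r > 0" "ball z r \<subseteq> V"
      using V open_contains_ball by (metis ex_in_conv)
    have "z \<in> closure D" using D by simp
    then obtain d where "d \<in> D" "dist d z < r / 4"
      using r(1) unfolding closure_approachable by (metis zero_less_divide_iff zero_less_numeral)
    then obtain i where i: "dist (q i) z < r / 4" using q by auto
    \<comment> \<open>The second component of the pair is free, so \<open>l\<close> can be taken large while the target stays \<open>q i\<close>.\<close>
    obtain j :: nat where "4 / r < real j" using reals_Archimedean2 by blast
    define l where "l = prod_encode (i, j)"
    have "j \<le> l" by (simp add: l_def le_prod_encode_2)
    with \<open>4 / r < real j\<close> have "4 / r < real l + 1" by linarith
    then have l: "1 / (real l + 1) < r / 4" using r(1) by (simp add: field_simps)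
    have "real (l + 1) \<le> 2 ^ l"
      by (metis Suc_eq_plus1 Suc_leI less_exp of_nat_le_iff of_nat_numeral of_nat_power)
    then have "(1/2) ^ l \<le> 1 / (real l + 1)" by (simp add: power_divide field_simps)
    with l have l': "2 * (1/2) ^ l < r / 2" by simp
    have inV: "T (real (a l k)) x \<in> V" for k
    proof -
      have "dist (T (real (a l k)) x) z
          \<le> dist (T (real (a l k)) x) (v l 0) + dist (v l 0) (target l) + dist (target l) z"
        using dist_triangle[of "T (real (a l k)) x" z "v l 0"] dist_triangle[of "v l 0" z "target l"]
        by linarith
      also have "\<dots> < r"
        using visit[of l k] near[of l] l l' i by (simp add: dist_norm target_def l_def)
      finally show ?thesis using r(2) by (auto simp: dist_commute)
    qed
    have inU: "T t x \<in> U" if t: "real (a l k) \<le> t" "t \<le> real (a l k) + \<eta>" for k t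
    proof -
      have "T t x = T (t - real (a l k)) (T (real (a l k)) x)"
        using assms(3) t unfolding C0_semigroup_def
        by (metis add.commute diff_add_cancel diff_ge_0_iff_ge of_nat_0_le_iff)
      then show ?thesis using VU[OF inV[of k], of "t - real (a l k)"] t by simp
    qed
    have "continuous_on {0..} (\<lambda>t. T t x)" using assms(3) by (simp add: C0_semigroup_def)
    then obtain W where "open W" "W \<inter> {0..} = (\<lambda>t. T t x) -` U \<inter> {0..}"
      using U(1) unfolding continuous_on_open_invariant by blast
    moreover from this have "{t. 0 \<le> t \<and> T t x \<in> U} = W \<inter> {0..}" by auto
    moreover from \<open>open W\<close> have "W \<inter> {0..} \<in> sets borel" by simp
    ultimately have meas: "{t. 0 \<le> t \<and> T t x \<in> U} \<in> sets lebesgue" by (simp only: sets_completionI_sets sets_lborel)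
    obtain c where c: "\<And>k. a l k \<le> c * (k + 1)" using a(2) by blast
    have "{real (a l k)..real (a l k) + \<eta>} \<subseteq> {t. 0 \<le> t \<and> T t x \<in> U}" for k
      using inU by (auto intro: order_trans[OF of_nat_0_le_iff])
    then show ?thesis by (rule lower_density_positive[OF meas a(1) c \<eta>])
  qed
  then show ?thesis unfolding frequently_hypercyclic_def by blast
qed

end
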